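(* Let $n,\nu\geq 1$ and $k\geq 4$, and let $P_n(w)$ be a non-redundant and irreducible $(2,k,\nu)$-special cyclic presentation where $w$ is an alternating word of length at least $4$. Then the cyclically presented group $G_n(w)$ defined by $P_n(w)$ is large.
   Context: Cyclic presentations: $F_n$ is the free group with basis $x_0,\ldots,x_{n-1}$ and $\theta:F_n\to F_n$ is the automorphism $\theta(x_i)=x_{i+1}$ (subscripts mod $n$). For a cyclically reduced word $w\in F_n$, $P_n(w)=\langle x_0,\ldots,x_{n-1}\mid w,\theta(w),\ldots,\theta^{n-1}(w)\rangle$ and $G_n(w)$ is the group it defines. Throughout it is assumed that $x_0$ is a letter of $w$. $P_n(w)$ is irreducible if the greatest common divisor of $n$ and the subscripts of the generators appearing in $w$ is $1$. A word is alternating if it has no cyclic subword of the form $(x_ix_j)^{\pm1}$. A group is large if it has a finite index subgroup that has a non-abelian free homomorphic image. Non-redundant: a relator $r\in R$ of $\langle X\mid R\rangle$ is freely redundant if it is freely trivial or there is $s\in R$ such that $r,s$ are distinct elements of the free group on $X$ and $r$ is freely conjugate to $s$ or to $s^{-1}$. A presentation is non-redundant if it contains no freely redundant relator. Star graph: let $\tilde R$ be the set of all cyclic permutations of elements of $R\cup R^{-1}$. The star graph of $\langle X\mid R\rangle$ (all relators cyclically reduced) is the undirected graph, possibly with multiple edges, with vertex set $X\cup X^{-1}$ and an edge joining $x$ and $y$ for each distinct word of the form $xy^{-1}u$ in $\tilde R$, where the edges corresponding to the inverse pair $xy^{-1}u$, $yx^{-1}u^{-1}$ are identified. Special presentations: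 let $m\geq 2$, $k\geq 3$, $\nu\geq 1$. A finite presentation $\langle X\mid R\rangle$ is $(m,k,\nu)$-special if (a) its star graph has exactly $\nu$ connected components, which are pairwise isomorphic, each a connected bipartite graph of diameter $m$ and girth $2m$ in which each vertex has degree at least $3$; (b) each relator has length $k$; (c) if $m=2$ then $k\geq 4$. Girth is the length of a shortest closed path in which consecutive edges are never equal (so a pair of parallel edges gives such a path of length $2$). *)

theory Defs
  imports "HOL-Algebra.Coset" "HOL-Library.Extended_Nat"
begin

section \<open>Free groups\<close>

text \<open>The letter \<open>(x, True)\<close> stands for the generator \<open>x\<close>, the letter \<open>(x, False)\<close> for
  \<open>x\<close> inverse.\<close>

type_synonym 'a letter = "'a \<times> bool"
type_synonym 'a word = "'a letter list"

definition inv_letter :: "'a letter \<Rightarrow> 'a letter" where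
  "inv_letter a = (fst a, \<not> snd a)"

definition inv_word :: "'a word \<Rightarrow> 'a word" where
  "inv_word w = map inv_letter (rev w)"

definition reduced :: "'a word \<Rightarrow> bool" where
  "reduced w \<longleftrightarrow> successively (\<lambda>a b. b \<noteq> inv_letter a) w"

definition cyclically_reduced :: "'a word \<Rightarrow> bool" where
  "cyclically_reduced w \<longleftrightarrow> reduced w \<and> (w \<noteq> [] \<longrightarrow> hd w \<noteq> inv_letter (last w))"

fun lmult :: "'a letter \<Rightarrow> 'a word \<Rightarrow> 'a word" where
  "lmult a [] = [a]"
| "lmult a (b # w) = (if b = inv_letter a then w else a # b # w)"

text \<open>Elements of the free group on \<open>X\<close> are the reduced words over \<open>X\<close>; for reduced words
  \<open>u\<close> and \<open>v\<close>, \<open>foldr lmult u v\<close> is the reduced form of \<open>u @ v\<close>.\<close>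

definition free_group :: "'a set \<Rightarrow> 'a word monoid" where
  "free_group X =
     \<lparr>carrier = {w. reduced w \<and> fst ` set w \<subseteq> X}, mult = foldr lmult, one = []\<rparr>"

lemma inv_letter_inv_letter [simp]: "inv_letter (inv_letter a) = a"
  by (simp add: inv_letter_def)

lemma fst_inv_letter [simp]: "fst (inv_letter a) = fst a"
  by (simp add: inv_letter_def)

lemma inv_letter_eq_iff: "inv_letter a = b \<longleftrightarrow> a = inv_letter b"
  by (metis inv_letter_inv_letter)

lemma reduced_Nil [simp]: "reduced []"
  by (simp add: reduced_def)

lemma reduced_Cons: "reduced (a # w) \<longleftrightarrow> reduced w \<and> (w = [] \<or> hd w \<noteq> inv_letter a)"
  by (cases w) (auto simp: reduced_def)

lemma reduced_lmult: "reduced w \<Longrightarrow> reduced (lmult a w)"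
  by (cases w) (auto simp: reduced_Cons)

lemma reduced_foldr_lmult: "reduced v \<Longrightarrow> reduced (foldr lmult u v)"
  by (induction u) (auto intro: reduced_lmult)

lemma set_lmult: "fst ` set (lmult a w) \<subseteq> insert (fst a) (fst ` set w)"
  by (cases w) auto

lemma set_foldr_lmult: "fst ` set (foldr lmult u v) \<subseteq> fst ` set u \<union> fst ` set v"
proof (induction u)
  case (Cons a u)
  have "fst ` set (foldr lmult (a # u) v) \<subseteq> insert (fst a) (fst ` set (foldr lmult u v))"
    using set_lmult by simp
  also have "\<dots> \<subseteq> fst ` set (a # u) \<union> fst ` set v"
    using Cons by (simp only: list.set image_insert) blast
  finally show ?case .
qed simp

lemma lmult_reduced: "reduced (a # w) \<Longrightarrow> lmult a w = a # w"
  by (cases w) (auto simp: reduced_Cons)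

lemma lmult_lmult_inv: "reduced w \<Longrightarrow> lmult a (lmult (inv_letter a) w) = w"
  by (cases w) (auto simp: reduced_Cons lmult_reduced)

lemma foldr_lmult_lmult:
  "reduced v \<Longrightarrow> foldr lmult (lmult a u) v = lmult a (foldr lmult u v)"
  by (cases u) (auto simp: lmult_lmult_inv reduced_foldr_lmult)

lemma foldr_lmult_assoc:
  "reduced z \<Longrightarrow> foldr lmult (foldr lmult u v) z = foldr lmult u (foldr lmult v z)"
  by (induction u) (auto simp: foldr_lmult_lmult)

lemma foldr_lmult_Nil: "reduced u \<Longrightarrow> foldr lmult u [] = u"
  by (induction u) (auto simp: lmult_reduced reduced_Cons)

lemma foldr_lmult_inv_word: "reduced u \<Longrightarrow> foldr lmult (inv_word u) u = []"
  by (induction u) (auto simp: inv_word_def reduced_Cons)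

lemma set_inv_word: "fst ` set (inv_word u) = fst ` set u"
  by (auto simp: inv_word_def image_image)

lemma reduced_inv_word:
  assumes "reduced u" shows "reduced (inv_word u)"
proof -
  have "successively (\<lambda>a b. a \<noteq> inv_letter b) (rev u)"
    using assms by (auto simp: reduced_def successively_rev inv_letter_eq_iff elim: successively_mono)
  then show ?thesis
    by (auto simp: reduced_def inv_word_def successively_map elim: successively_mono)
qed

lemma group_free_group: "group (free_group X)"
proof (rule groupI)
  fix u v assume "u \<in> carrier (free_group X)" "v \<in> carrier (free_group X)"
  then show "u \<otimes>\<^bsub>free_group X\<^esub> v \<in> carrier (free_group X)"
    using order_trans[OF set_foldr_lmult[of u v]] by (simp add: free_group_def reduced_foldr_lmult)
next
  fix u assume u: "u \<in> carrier (free_group X)"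
  then show "\<exists>v\<in>carrier (free_group X). v \<otimes>\<^bsub>free_group X\<^esub> u = \<one>\<^bsub>free_group X\<^esub>"
    by (intro bexI[of _ "inv_word u"])
       (auto simp: free_group_def foldr_lmult_inv_word reduced_inv_word set_inv_word)
qed (auto simp: free_group_def foldr_lmult_assoc)

lemma inv_free_group:
  assumes "u \<in> carrier (free_group X)"
  shows "inv\<^bsub>free_group X\<^esub> u = inv_word u"
  by (rule group.inv_equality[OF group_free_group])
     (use assms in \<open>auto simp: free_group_def foldr_lmult_inv_word reduced_inv_word set_inv_word\<close>)


section \<open>Group presentations\<close>

text \<open>A presentation is a pair \<open>(X, R)\<close> of a set of generators and a set of relators, the latter
  being elements of the free group on \<open>X\<close>.\<close>

type_synonym 'a presentation = "'a set \<times> 'a word set"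

definition is_presentation :: "'a presentation \<Rightarrow> bool" where
  "is_presentation P \<longleftrightarrow> snd P \<subseteq> carrier (free_group (fst P))"

definition finite_presentation :: "'a presentation \<Rightarrow> bool" where
  "finite_presentation P \<longleftrightarrow> is_presentation P \<and> finite (fst P) \<and> finite (snd P)"

definition normal_closure :: "('g, 'm) monoid_scheme \<Rightarrow> 'g set \<Rightarrow> 'g set" where
  "normal_closure G R = \<Inter>{N. N \<lhd> G \<and> R \<subseteq> N}"

definition presented_group :: "'a presentation \<Rightarrow> 'a word set monoid" where
  "presented_group P = free_group (fst P) Mod normal_closure (free_group (fst P)) (snd P)"

lemma (in group) normal_closure_normal:
  assumes "R \<subseteq> carrier G"
  shows "normal_closure G R \<lhd> G"
proof -
  have ne: "{N. N \<lhd> G \<and> R \<subseteq> N} \<noteq> {}"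
    using assms subgroup_self by (auto simp: normal_inv_iff)
  have "subgroup (normal_closure G R) G"
    unfolding normal_closure_def
    by (rule subgroups_Inter) (use ne in \<open>auto simp: normal_imp_subgroup\<close>)
  moreover have "x \<otimes> h \<otimes> inv x \<in> normal_closure G R"
    if "x \<in> carrier G" "h \<in> normal_closure G R" for x h
    using that by (auto simp: normal_closure_def normal_inv_iff)
  ultimately show ?thesis
    by (simp add: normal_inv_iff)
qed

lemma group_presented_group:
  assumes "is_presentation P"
  shows "group (presented_group P)"
  unfolding presented_group_def
  by (rule normal.factorgroup_is_group, rule group.normal_closure_normal[OF group_free_group])
     (use assms in \<open>simp add: is_presentation_def\<close>)

definition freely_conjugate :: "'a set \<Rightarrow> 'a word \<Rightarrow> 'a word \<Rightarrow> bool" where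
  "freely_conjugate X r s \<longleftrightarrow> (\<exists>g\<in>carrier (free_group X).
     r = g \<otimes>\<^bsub>free_group X\<^esub> s \<otimes>\<^bsub>free_group X\<^esub> inv\<^bsub>free_group X\<^esub> g)"

definition freely_redundant :: "'a presentation \<Rightarrow> 'a word \<Rightarrow> bool" where
  "freely_redundant P r \<longleftrightarrow>
     r = \<one>\<^bsub>free_group (fst P)\<^esub> \<or>
     (\<exists>s\<in>snd P. r \<noteq> s \<and>
        (freely_conjugate (fst P) r s \<or>
         freely_conjugate (fst P) r (inv\<^bsub>free_group (fst P)\<^esub> s)))"

definition non_redundant :: "'a presentation \<Rightarrow> bool" where
  "non_redundant P \<longleftrightarrow> (\<forall>r\<in>snd P. \<not> freely_redundant P r)"


section \<open>Large groups\<close>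

text \<open>A basis of a free homomorphic image of a subgroup of \<open>G\<close> can be lifted to a subset of
  \<open>G\<close>, so restricting to bases \<open>X\<close> of the element type of \<open>G\<close> loses no free images.\<close>

definition large :: "('g, 'm) monoid_scheme \<Rightarrow> bool" where
  "large G \<longleftrightarrow> (\<exists>H. subgroup H G \<and> finite (rcosets\<^bsub>G\<^esub> H) \<and>
     (\<exists>X :: 'g set. \<not> comm_group (free_group X) \<and>
        epi (G\<lparr>carrier := H\<rparr>) (free_group X) \<noteq> {}))"


section \<open>Undirected multigraphs\<close>

record ('v, 'e) multigraph =
  verts :: "'v set"
  edges :: "'e set"
  ends :: "'e \<Rightarrow> 'v set"

inductive walk :: "('v, 'e) multigraph \<Rightarrow> 'v \<Rightarrow> 'e list \<Rightarrow> 'v \<Rightarrow> bool" for G where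
  "v \<in> verts G \<Longrightarrow> walk G v [] v"
| "u \<in> verts G \<Longrightarrow> e \<in> edges G \<Longrightarrow> ends G e = {u, v} \<Longrightarrow> walk G v p w \<Longrightarrow> walk G u (e # p) w"

definition connected_graph :: "('v, 'e) multigraph \<Rightarrow> bool" where
  "connected_graph G \<longleftrightarrow> verts G \<noteq> {} \<and> (\<forall>u\<in>verts G. \<forall>v\<in>verts G. \<exists>p. walk G u p v)"

definition induced :: "('v, 'e) multigraph \<Rightarrow> 'v set \<Rightarrow> ('v, 'e) multigraph" where
  "induced G S = \<lparr>verts = S, edges = {e \<in> edges G. ends G e \<subseteq> S}, ends = ends G\<rparr>"

definition components :: "('v, 'e) multigraph \<Rightarrow> ('v, 'e) multigraph set" where
  "components G = (\<lambda>u. induced G {v. \<exists>p. walk G u p v}) ` verts G"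

definition isomorphic_graphs :: "('v, 'e) multigraph \<Rightarrow> ('w, 'f) multigraph \<Rightarrow> bool" where
  "isomorphic_graphs G H \<longleftrightarrow> (\<exists>f g. bij_betw f (verts G) (verts H) \<and>
     bij_betw g (edges G) (edges H) \<and> (\<forall>e\<in>edges G. ends H (g e) = f ` ends G e))"

definition bipartite_graph :: "('v, 'e) multigraph \<Rightarrow> bool" where
  "bipartite_graph G \<longleftrightarrow> (\<exists>A B. A \<union> B = verts G \<and> A \<inter> B = {} \<and>
     (\<forall>e\<in>edges G. \<exists>a\<in>A. \<exists>b\<in>B. ends G e = {a, b}))"

text \<open>Loops count twice.\<close>

definition degree :: "('v, 'e) multigraph \<Rightarrow> 'v \<Rightarrow> nat" where
  "degree G v = card {e \<in> edges G. v \<in> ends G e} + card {e \<in> edges G. ends G e = {v}}"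

definition graph_dist :: "('v, 'e) multigraph \<Rightarrow> 'v \<Rightarrow> 'v \<Rightarrow> enat" where
  "graph_dist G u v = Inf {enat (length p) | p. walk G u p v}"

definition graph_diameter :: "('v, 'e) multigraph \<Rightarrow> enat" where
  "graph_diameter G = Sup {graph_dist G u v | u v. u \<in> verts G \<and> v \<in> verts G}"

definition girth :: "('v, 'e) multigraph \<Rightarrow> enat" where
  "girth G = Inf {enat (length p) | v p. p \<noteq> [] \<and> walk G v p v \<and> distinct_adj p}"


section \<open>Star graphs and special presentations\<close>

definition cyclic_perms :: "'a list \<Rightarrow> 'a list set" where
  "cyclic_perms w = {rotate i w | i. True}"

definition relator_closure :: "'a presentation \<Rightarrow> 'a word set" where
  "relator_closure P = (\<Union>r\<in>snd P \<union> inv_word ` snd P. cyclic_perms r)"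

text \<open>An edge is the pair of words \<open>x y\<inverse> u\<close> and \<open>y x\<inverse> u\<inverse>\<close>; it joins \<open>x\<close> and \<open>y\<close>, which
  are letters (generators or their inverses).\<close>

definition star_graph :: "'a presentation \<Rightarrow> ('a letter, 'a word set) multigraph" where
  "star_graph P =
     \<lparr>verts = fst P \<times> UNIV,
      edges = {{x # inv_letter y # u, y # inv_letter x # inv_word u} | x y u.
                 x # inv_letter y # u \<in> relator_closure P},
      ends = (\<lambda>e. {x. \<exists>y u. x # inv_letter y # u \<in> e})\<rparr>"

definition special :: "nat \<Rightarrow> nat \<Rightarrow> nat \<Rightarrow> 'a presentation \<Rightarrow> bool" where
  "special m k \<nu> P \<longleftrightarrow>
     m \<ge> 2 \<and> k \<ge> 3 \<and> \<nu> \<ge> 1 \<and>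
     finite_presentation P \<and> (\<forall>r\<in>snd P. cyclically_reduced r) \<and>
     card (components (star_graph P)) = \<nu> \<and>
     (\<forall>C\<in>components (star_graph P). \<forall>D\<in>components (star_graph P). isomorphic_graphs C D) \<and>
     (\<forall>C\<in>components (star_graph P).
        connected_graph C \<and> bipartite_graph C \<and>
        graph_diameter C = enat m \<and> girth C = enat (2 * m) \<and>
        (\<forall>v\<in>verts C. degree C v \<ge> 3)) \<and>
     (\<forall>r\<in>snd P. length r = k) \<and>
     (m = 2 \<longrightarrow> k \<ge> 4)"


section \<open>Cyclic presentations\<close>

text \<open>The generator \<open>x\<^sub>i\<close> is the number \<open>i\<close>. Substituting letter by letter preserves reducedness,
  so \<open>shift n\<close> is the automorphism of the free group on \<open>{..<n}\<close> sending \<open>x\<^sub>i\<close> to \<open>x\<^sub>i\<^sub>+\<^sub>1\<close>.\<close>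

definition shift :: "nat \<Rightarrow> nat word \<Rightarrow> nat word" where
  "shift n w = map (\<lambda>(i, e). ((i + 1) mod n, e)) w"

definition cyclic_presentation :: "nat \<Rightarrow> nat word \<Rightarrow> nat presentation" where
  "cyclic_presentation n w = ({..<n}, {(shift n ^^ j) w | j. j < n})"

definition cyclically_presented_group :: "nat \<Rightarrow> nat word \<Rightarrow> nat word set monoid" where
  "cyclically_presented_group n w = presented_group (cyclic_presentation n w)"

definition irreducible_cyclic_presentation :: "nat \<Rightarrow> nat word \<Rightarrow> bool" where
  "irreducible_cyclic_presentation n w \<longleftrightarrow> Gcd (insert n (fst ` set w)) = 1"

definition cyclic_subword :: "'a list \<Rightarrow> 'a list \<Rightarrow> bool" where
  "cyclic_subword u w \<longleftrightarrow> (\<exists>v\<in>cyclic_perms w. \<exists>t. v = u @ t)"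

definition alternating :: "'a word \<Rightarrow> bool" where
  "alternating w \<longleftrightarrow> (\<forall>i j. \<not> cyclic_subword [(i, True), (j, True)] w \<and>
     \<not> cyclic_subword (inv_word [(i, True), (j, True)]) w)"

end

theory Submission
  imports Defs "HOL-Algebra.Bij"
begin

text \<open>Since \<open>w\<close> is alternating, the star graph is the disjoint union of a graph on the
  generators and a graph on their inverses. Both are invariant under the shift, so the component
  of the vertex \<open>0\<close> in each of them consists of the multiples of some divisor of \<open>n\<close>. As the
  components are isomorphic, the two divisors agree, and irreducibility forces them to be \<open>1\<close>. A
  connected bipartite shift-invariant graph on the integers modulo \<open>n\<close> can only be bipartite by
  parity. Hence \<open>n\<close> is even and the subscripts in \<open>w\<close> alternate in parity, like the signs.

  If \<open>w\<close> has length \<open>2m\<close>, then sending the generators with even subscript to \<open>s\<close> and the others to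
  \<open>t\<close> maps the group onto \<open>\<langle>s, t | (s t\<inverse>)\<^sup>m\<rangle>\<close>, the free product of an infinite cyclic group and
  a cyclic group of order \<open>m \<ge> 2\<close>, whose kernel to the second factor is free of rank \<open>m\<close>.
  This is made explicit by an action of the group on \<open>m\<close> copies of a free group of rank two.\<close>

section \<open>Actions of presented groups\<close>

lemma Bij_if_left_right_inverse:
  assumes "f \<in> E \<rightarrow> E" "g \<in> E \<rightarrow> E"
    and "\<And>p. p \<in> E \<Longrightarrow> f (g p) = p" "\<And>p. p \<in> E \<Longrightarrow> g (f p) = p"
  shows "restrict f E \<in> Bij E"
proof -
  have "bij_betw f E E"
    by (rule bij_betw_byWitness[where f' = g]) (use assms in auto)
  then show ?thesis
    by (simp add: Bij_def cong: bij_betw_cong)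
qed

text \<open>The universal property of the free group, for permutations: \<open>act\<close> undoes
  each letter by its inverse, so cancelling a pair in \<open>lmult\<close> does not change the
  composite along a word. Restriction to \<open>E\<close> is needed because elements of
  \<open>BijGroup E\<close> are extensional.\<close>

lemma free_group_hom_BijGroup:
  assumes maps: "\<And>a. fst a \<in> X \<Longrightarrow> act a \<in> E \<rightarrow> E"
    and cancel: "\<And>a p. fst a \<in> X \<Longrightarrow> p \<in> E \<Longrightarrow> act a (act (inv_letter a) p) = p"
  shows "(\<lambda>v. restrict (foldr act v) E) \<in> hom (free_group X) (BijGroup E)"
proof -
  have stable: "foldr act v \<in> E \<rightarrow> E" if "fst ` set v \<subseteq> X" for v
    using that maps by (induction v) (auto simp: Pi_iff)
  have lmult: "foldr act (lmult a v) p = act a (foldr act v p)"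
    if "fst a \<in> X" "fst ` set v \<subseteq> X" "p \<in> E" for a v p
  proof (cases v)
    case (Cons b u)
    then show ?thesis
      using that cancel[of a "foldr act u p"] stable[of u] by (auto simp: Pi_iff)
  qed simp
  have mult: "foldr act (foldr lmult u v) p = foldr act u (foldr act v p)"
    if "fst ` set u \<subseteq> X" "fst ` set v \<subseteq> X" "p \<in> E" for u v p
    using that(1)
  proof (induction u)
    case (Cons a u)
    then have "fst ` set (foldr lmult u v) \<subseteq> X"
      using order_trans[OF set_foldr_lmult[of u v]] that(2) by simp
    with Cons that show ?case
      by (simp add: lmult)
  qed simp
  have mem: "restrict (foldr act v) E \<in> Bij E" if v: "v \<in> carrier (free_group X)" for v
  proof -
    have vs: "reduced v" "fst ` set v \<subseteq> X" "fst ` set (inv_word v) \<subseteq> X" "reduced (inv_word v)"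
      using v by (auto simp: free_group_def set_inv_word reduced_inv_word)
    have inv2: "inv_word (inv_word v) = v"
      by (simp add: inv_word_def rev_map o_def)
    show ?thesis
    proof (rule Bij_if_left_right_inverse[where g = "foldr act (inv_word v)"])
      fix p assume "p \<in> E"
      then show "foldr act v (foldr act (inv_word v) p) = p"
        and "foldr act (inv_word v) (foldr act v p) = p"
        using mult[OF vs(2,3), of p] mult[OF vs(3,2), of p] foldr_lmult_inv_word[OF vs(1)]
          foldr_lmult_inv_word[OF vs(4)] inv2
        by auto
    qed (use stable vs in auto)
  qed
  show ?thesis
  proof (rule homI)
    fix u v assume uv: "u \<in> carrier (free_group X)" "v \<in> carrier (free_group X)"
    then have s: "fst ` set u \<subseteq> X" "fst ` set v \<subseteq> X"
      by (auto simp: free_group_def)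
    show "restrict (foldr act (u \<otimes>\<^bsub>free_group X\<^esub> v)) E =
        restrict (foldr act u) E \<otimes>\<^bsub>BijGroup E\<^esub> restrict (foldr act v) E"
      using mem[OF uv(1)] mem[OF uv(2)] mult[OF s] stable[OF s(2)]
      by (auto simp: BijGroup_def compose_def free_group_def fun_eq_iff Pi_iff)
  qed (use mem in \<open>simp add: BijGroup_def\<close>)
qed

text \<open>The kernel of \<open>h\<close> is a normal subgroup containing all relators, hence
  contains their normal closure, and \<open>h\<close> factors through the quotient.\<close>

lemma presented_group_hom:
  assumes P: "is_presentation P" and Q: "group Q"
    and h: "h \<in> hom (free_group (fst P)) Q" and R: "\<And>r. r \<in> snd P \<Longrightarrow> h r = \<one>\<^bsub>Q\<^esub>"
  obtains f where "f \<in> hom (presented_group P) Q"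
    and "\<And>v. v \<in> carrier (free_group (fst P)) \<Longrightarrow>
      f (r_coset (free_group (fst P)) (normal_closure (free_group (fst P)) (snd P)) v) = h v"
proof -
  let ?F = "free_group (fst P)"
  interpret group_hom ?F Q h
    using h Q by (simp add: group_hom_def group_hom_axioms_def group_free_group)
  have sub: "snd P \<subseteq> carrier ?F"
    using P by (simp add: is_presentation_def)
  have "normal_closure ?F (snd P) \<subseteq> kernel ?F Q h"
    unfolding normal_closure_def using normal_kernel sub R by (auto simp: kernel_def)
  then obtain f where "f \<in> hom (?F Mod normal_closure ?F (snd P)) Q"
    and "\<And>x. x \<in> carrier ?F \<Longrightarrow> f (r_coset ?F (normal_closure ?F (snd P)) x) = h x"
    using FactGroup_universal_kernel[OF group.normal_closure_normal[OF group_free_group sub]] by metis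
  then show ?thesis
    using that by (simp add: presented_group_def)
qed

section \<open>A criterion for largeness by actions on finitely many copies of a free group\<close>

text \<open>The elements that keep copy \<open>c0\<close> in place form a subgroup of index at most
  \<open>card C\<close>. Since the action commutes with right multiplication, an element of this
  subgroup acts on that copy as left multiplication by the image of the identity, which gives a
  homomorphism to the free group; \<open>surj\<close> makes it onto.\<close>

lemma large_if_equivariant_action:
  fixes G :: "('g, 'm) monoid_scheme" and X :: "'g set"
  assumes G: "group G" and C: "finite C" "c0 \<in> C"
    and noncomm: "\<not> comm_group (free_group X)"
    and f: "f \<in> hom G (BijGroup (C \<times> carrier (free_group X)))"
    and equivariant: "\<And>x c g h. x \<in> carrier G \<Longrightarrow> c \<in> C \<Longrightarrow> g \<in> carrier (free_group X) \<Longrightarrow>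
      h \<in> carrier (free_group X) \<Longrightarrow>
      f x (c, g \<otimes>\<^bsub>free_group X\<^esub> h) = (fst (f x (c, g)), snd (f x (c, g)) \<otimes>\<^bsub>free_group X\<^esub> h)"
    and surj: "\<And>g. g \<in> carrier (free_group X) \<Longrightarrow>
      \<exists>x\<in>carrier G. f x (c0, \<one>\<^bsub>free_group X\<^esub>) = (c0, g)"
  shows "large G"
proof -
  let ?F = "free_group X"
  let ?E = "C \<times> carrier ?F"
  interpret G: group G by fact
  interpret F: group ?F by (rule group_free_group)
  interpret B: group "BijGroup ?E" by (rule group_BijGroup)
  interpret h: group_hom G "BijGroup ?E" f
    by (simp add: group_hom_def group_hom_axioms_def f G B.is_group)
  note h.hom_inv [simp del]
  have mem: "f x \<in> Bij ?E" if "x \<in> carrier G" for x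
    using h.hom_closed[OF that] by (simp add: BijGroup_def)
  have maps: "f x p \<in> ?E" if "x \<in> carrier G" "p \<in> ?E" for x p
    using Bij_imp_funcset[OF mem[OF that(1)]] that(2) by blast
  have mult: "f (x \<otimes>\<^bsub>G\<^esub> y) p = f x (f y p)"
    if "x \<in> carrier G" "y \<in> carrier G" "p \<in> ?E" for x y p
    using h.hom_mult[OF that(1,2)] mem that by (simp add: BijGroup_def compose_def)
  have one: "f \<one>\<^bsub>G\<^esub> p = p" if "p \<in> ?E" for p
    using h.hom_one that by (simp add: BijGroup_def)
  define p0 where "p0 = (c0, \<one>\<^bsub>?F\<^esub>)"
  have p0: "p0 \<in> ?E"
    using C by (simp add: p0_def)
  \<comment> \<open>Equivariance at the identity: each element is determined by its effect on the
    identities of the copies.\<close>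
  have fact: "f x (c, g) = (fst (f x (c, \<one>\<^bsub>?F\<^esub>)), snd (f x (c, \<one>\<^bsub>?F\<^esub>)) \<otimes>\<^bsub>?F\<^esub> g)"
    if "x \<in> carrier G" "c \<in> C" "g \<in> carrier ?F" for x c g
    using equivariant[OF that(1,2) F.one_closed that(3)] that(3) by simp
  define H where "H = {x \<in> carrier G. fst (f x p0) = c0}"
  have Hmem: "fst (f x p) = c0" if x: "x \<in> H" and p: "p \<in> ?E" "fst p = c0" for x p
  proof -
    obtain g where "p = (c0, g)" "g \<in> carrier ?F"
      using p by (cases p) auto
    then show ?thesis
      using fact[of x c0 g] x C by (simp add: H_def p0_def)
  qed
  \<comment> \<open>If \<open>x\<close> moves copy \<open>c0\<close> to the copy of
    \<open>p\<close>, then its inverse moves that copy back, wherever \<open>p\<close> lies within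
    it.\<close>
  have inv_fst: "fst (f (inv\<^bsub>G\<^esub> x) p) = c0" if x: "x \<in> carrier G" and p: "p \<in> ?E"
    and eq: "fst (f x p0) = fst p" for x p
  proof -
    obtain c g where fx: "f x p0 = (c, g)" "c \<in> C" "g \<in> carrier ?F"
      using maps[OF x p0] by (cases "f x p0") auto
    obtain g' where p': "p = (c, g')" "g' \<in> carrier ?F"
      using p eq fx by (cases p) auto
    have "f (inv\<^bsub>G\<^esub> x) (c, g) = p0"
      using mult[OF G.inv_closed[OF x] x p0] one[OF p0] x fx(1) by simp
    then show ?thesis
      using fact[of "inv\<^bsub>G\<^esub> x" c g] fact[of "inv\<^bsub>G\<^esub> x" c g'] p' fx x by (simp add: p0_def)
  qed
  have H: "subgroup H G"
  proof
    show "H \<subseteq> carrier G" by (auto simp: H_def)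
    show "\<one>\<^bsub>G\<^esub> \<in> H" using one[OF p0] by (simp add: H_def p0_def)
    fix x assume x: "x \<in> H"
    then show "inv\<^bsub>G\<^esub> x \<in> H"
      using inv_fst[of x p0] p0 by (auto simp: H_def p0_def)
    fix y assume y: "y \<in> H"
    then have "fst (f y p0) = c0" "f y p0 \<in> ?E"
      using maps[OF _ p0] by (auto simp: H_def)
    then show "x \<otimes>\<^bsub>G\<^esub> y \<in> H"
      using x y Hmem[OF x, of "f y p0"] mult[of x y p0] p0 by (auto simp: H_def)
  qed
  have finite: "finite (rcosets\<^bsub>G\<^esub> H)"
  proof -
    \<comment> \<open>The right coset of \<open>x\<close> is determined by the copy to which the
      inverse of \<open>x\<close> moves \<open>p0\<close>, so there are at most as many cosets as
      copies.\<close>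
    let ?c = "\<lambda>x. fst (f (inv\<^bsub>G\<^esub> x) p0)"
    have same: "H #>\<^bsub>G\<^esub> x = H #>\<^bsub>G\<^esub> y" if x: "x \<in> carrier G" and y: "y \<in> carrier G" and eq: "?c x = ?c y" for x y
    proof -
      have m: "f (inv\<^bsub>G\<^esub> y) p0 \<in> ?E"
        using maps y p0 by simp
      have "fst (f x (f (inv\<^bsub>G\<^esub> y) p0)) = c0"
        using inv_fst[OF G.inv_closed[OF x] m] eq x by simp
      then have "x \<otimes>\<^bsub>G\<^esub> inv\<^bsub>G\<^esub> y \<in> H"
        using x y mult[of x "inv\<^bsub>G\<^esub> y" p0] p0 by (simp add: H_def)
      then have "x \<in> H #>\<^bsub>G\<^esub> y"
        using subgroup.rcos_module_rev[OF H G y x] by simp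
      then show ?thesis
        using G.repr_independence[OF _ y H] by simp
    qed
    have "rcosets\<^bsub>G\<^esub> H \<subseteq> (\<lambda>c. H #>\<^bsub>G\<^esub> (SOME x. x \<in> carrier G \<and> ?c x = c)) ` C"
    proof
      fix K assume "K \<in> rcosets\<^bsub>G\<^esub> H"
      then obtain x where x: "x \<in> carrier G" "K = H #>\<^bsub>G\<^esub> x"
        by (auto simp: RCOSETS_def)
      let ?y = "SOME y. y \<in> carrier G \<and> ?c y = ?c x"
      have y: "?y \<in> carrier G \<and> ?c ?y = ?c x"
        by (rule someI[of _ x]) (use x in simp)
      have "?c x \<in> C"
        using maps[OF G.inv_closed[OF x(1)] p0] by (simp add: mem_Times_iff)
      moreover have "K = H #>\<^bsub>G\<^esub> ?y"
        using same[OF x(1), of ?y] y x(2) by simp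
      ultimately show "K \<in> (\<lambda>c. H #>\<^bsub>G\<^esub> (SOME x. x \<in> carrier G \<and> ?c x = c)) ` C"
        by (rule rev_image_eqI)
    qed
    then show ?thesis
      using C finite_surj by blast
  qed
  have "(\<lambda>x. snd (f x p0)) \<in> epi (G\<lparr>carrier := H\<rparr>) ?F"
    unfolding epi_def
  proof (intro CollectI conjI homI)
    fix x y assume "x \<in> carrier (G\<lparr>carrier := H\<rparr>)" "y \<in> carrier (G\<lparr>carrier := H\<rparr>)"
    then have xy: "x \<in> carrier G" "y \<in> carrier G" "fst (f y p0) = c0"
      by (auto simp: H_def)
    moreover have "snd (f y p0) \<in> carrier ?F"
      using maps[OF xy(2) p0] by (simp add: mem_Times_iff)
    ultimately have "f x (c0, snd (f y p0)) = (fst (f x p0), snd (f x p0) \<otimes>\<^bsub>?F\<^esub> snd (f y p0))"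
      using fact[of x c0 "snd (f y p0)"] C by (simp add: p0_def)
    then have "f x (f y p0) = (fst (f x p0), snd (f x p0) \<otimes>\<^bsub>?F\<^esub> snd (f y p0))"
      using xy(3) by (metis prod.collapse)
    then show "snd (f (x \<otimes>\<^bsub>G\<lparr>carrier := H\<rparr>\<^esub> y) p0) = snd (f x p0) \<otimes>\<^bsub>?F\<^esub> snd (f y p0)"
      using mult[OF xy(1,2) p0] by simp
  next
    fix x assume "x \<in> carrier (G\<lparr>carrier := H\<rparr>)"
    then have "f x p0 \<in> ?E"
      using maps p0 by (simp add: H_def)
    then show "snd (f x p0) \<in> carrier ?F"
      by (simp add: mem_Times_iff)
  next
    have "g \<in> (\<lambda>x. snd (f x p0)) ` H" if g: "g \<in> carrier ?F" for g
    proof -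
      obtain x where "x \<in> carrier G" "f x p0 = (c0, g)"
        using surj[OF g] by (auto simp: p0_def)
      then show ?thesis
        by (intro rev_image_eqI[of x]) (auto simp: H_def)
    qed
    moreover have "snd (f x p0) \<in> carrier ?F" if "x \<in> H" for x
      using that maps[OF _ p0, of x] by (simp add: H_def mem_Times_iff)
    ultimately show "(\<lambda>x. snd (f x p0)) ` carrier (G\<lparr>carrier := H\<rparr>) = carrier ?F"
      by auto
  qed
  then show ?thesis
    using H finite noncomm unfolding large_def by blast
qed

lemma not_comm_free_group:
  assumes "x \<in> X" "y \<in> X" "x \<noteq> y"
  shows "\<not> comm_group (free_group X)"
proof
  assume "comm_group (free_group X)"
  moreover have "[(x, True)] \<in> carrier (free_group X)" "[(y, True)] \<in> carrier (free_group X)"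
    using assms by (auto simp: free_group_def reduced_Cons)
  ultimately have "[(x, True)] \<otimes>\<^bsub>free_group X\<^esub> [(y, True)] = [(y, True)] \<otimes>\<^bsub>free_group X\<^esub> [(x, True)]"
    by (meson comm_monoid.m_comm comm_group.axioms(1))
  then show False
    using assms by (auto simp: free_group_def inv_letter_def)
qed

section \<open>The explicit action\<close>

text \<open>In the free product of the infinite cyclic group of \<open>s\<close> with the rotations,
  the conjugates of \<open>s\<close> by rotations form a basis of the kernel onto the rotations. On
  copy 0 just two of these conjugates act nontrivially, as \<open>a\<close> and \<open>b\<close>:
  rank two is enough for largeness.\<close>

definition gen_act :: "'b \<Rightarrow> 'b \<Rightarrow> bool \<Rightarrow> nat \<times> 'b word \<Rightarrow> nat \<times> 'b word" where
  "gen_act a b e = (\<lambda>(c, g). (c, if c = 0 then lmult (a, e) g else if c = 1 then lmult (b, e) g else g))"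

text \<open>Adding \<open>m - 1\<close> is subtracting 1 modulo \<open>m\<close>, so
  \<open>e = False\<close> gives the inverse rotation within the natural numbers.\<close>

definition rot :: "nat \<Rightarrow> bool \<Rightarrow> nat \<times> 'b word \<Rightarrow> nat \<times> 'b word" where
  "rot m e = (\<lambda>(c, g). ((c + (if e then 1 else m - 1)) mod m, g))"

text \<open>A generator with even subscript acts as \<open>s = gen_act\<close>, one with odd subscript as
  \<open>t = rot\<inverse> \<circ> s\<close>, so that \<open>s \<circ> t\<inverse>\<close> is the rotation \<open>rot\<close> of the \<open>m\<close> copies.\<close>

definition letter_act :: "'b \<Rightarrow> 'b \<Rightarrow> nat \<Rightarrow> nat letter \<Rightarrow> nat \<times> 'b word \<Rightarrow> nat \<times> 'b word" where
  "letter_act a b m = (\<lambda>(i, e). if even i then gen_act a b e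
     else if e then rot m False \<circ> gen_act a b True else gen_act a b False \<circ> rot m True)"

lemma lmult_free_group_closed:
  assumes "g \<in> carrier (free_group X)" "x \<in> X"
  shows "lmult (x, e) g \<in> carrier (free_group X)"
  using assms order_trans[OF set_lmult[of "(x, e)" g]] by (simp add: free_group_def reduced_lmult)

lemma gen_act_closed:
  "p \<in> {..<m} \<times> carrier (free_group {a, b}) \<Longrightarrow> gen_act a b e p \<in> {..<m} \<times> carrier (free_group {a, b})"
  by (auto simp: gen_act_def intro!: lmult_free_group_closed)

lemma rot_closed:
  "p \<in> {..<m} \<times> F \<Longrightarrow> rot m e p \<in> {..<m} \<times> F"
  by (auto simp: rot_def)

lemma gen_act_cancel:
  assumes "p \<in> {..<m} \<times> carrier (free_group {a, b})"
  shows "gen_act a b e (gen_act a b (\<not> e) p) = p"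
  using assms lmult_lmult_inv[of "snd p" "(a, e)"] lmult_lmult_inv[of "snd p" "(b, e)"]
  by (auto simp: gen_act_def inv_letter_def free_group_def)

lemma rot_cancel: "p \<in> {..<m} \<times> F \<Longrightarrow> rot m e (rot m (\<not> e) p) = p"
  by (cases e; cases "Suc (fst p) = m") (auto simp: rot_def mod_simps le_mod_geq)

lemma letter_act_closed:
  "letter_act a b m l \<in> {..<m} \<times> carrier (free_group {a, b}) \<rightarrow> {..<m} \<times> carrier (free_group {a, b})"
  by (simp add: letter_act_def gen_act_closed rot_closed split: prod.split)

lemma letter_act_cancel:
  assumes "p \<in> {..<m} \<times> carrier (free_group {a, b})"
  shows "letter_act a b m l (letter_act a b m (inv_letter l) p) = p"
proof -
  have c: "gen_act a b e p \<in> {..<m} \<times> carrier (free_group {a, b})"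
    "rot m e p \<in> {..<m} \<times> carrier (free_group {a, b})" for e
    using assms by (auto intro: gen_act_closed rot_closed)
  show ?thesis
    using gen_act_cancel[OF c(2), of True] gen_act_cancel[OF assms, of True]
      gen_act_cancel[OF assms, of False] rot_cancel[OF c(1), of True] rot_cancel[OF assms, of False]
    by (cases l; cases "even (fst l)"; cases "snd l") (simp_all add: letter_act_def inv_letter_def)
qed

text \<open>Letters act by left multiplication and by permuting copies; both commute with right
  multiplication.\<close>

lemma letter_act_mult:
  assumes "reduced g" "reduced h"
  shows "letter_act a b m l (c, foldr lmult g h) =
    (fst (letter_act a b m l (c, g)), foldr lmult (snd (letter_act a b m l (c, g))) h)"
  using assms by (cases l) (auto simp: letter_act_def gen_act_def rot_def foldr_lmult_lmult)

lemma foldr_letter_act_closed: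
  assumes "p \<in> {..<m} \<times> carrier (free_group {a, b})"
  shows "foldr (letter_act a b m) v p \<in> {..<m} \<times> carrier (free_group {a, b})"
  using assms by (induction v) (simp_all add: funcset_mem[OF letter_act_closed])

lemma foldr_letter_act_mult:
  assumes "c < m" "g \<in> carrier (free_group {a, b})" "h \<in> carrier (free_group {a, b})"
  shows "foldr (letter_act a b m) v (c, foldr lmult g h) =
    (fst (foldr (letter_act a b m) v (c, g)), foldr lmult (snd (foldr (letter_act a b m) v (c, g))) h)"
proof (induction v)
  case (Cons l v)
  obtain c' g' where eq: "foldr (letter_act a b m) v (c, g) = (c', g')"
    by fastforce
  moreover have "(c', g') \<in> {..<m} \<times> carrier (free_group {a, b})"
    using foldr_letter_act_closed[of "(c, g)" m a b v] assms eq by simp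
  ultimately show ?case
    using Cons letter_act_mult[of g' h] assms(3) by (simp add: free_group_def)
qed simp

section \<open>Triviality of the relators in the action\<close>

lemma rot_funpow: "(rot m e ^^ j) (c, g) = (if j = 0 then c else (c + j * (if e then 1 else m - 1)) mod m, g)"
proof (induction j)
  case (Suc j)
  then show ?case by (simp add: rot_def mod_simps algebra_simps)
qed simp

lemma rot_funpow_self:
  assumes "p \<in> {..<m} \<times> F"
  shows "(rot m e ^^ m) p = p"
  using assms by (cases p) (auto simp: rot_funpow)

lemma foldr_concat_replicate: "foldr f (concat (replicate j u)) p = (foldr f u ^^ j) p"
  by (induction j) simp_all

text \<open>The factors \<open>h\<close> and \<open>g\<close> between consecutive occurrences of
  \<open>r\<close> cancel. The case \<open>j = 0\<close> is separate because \<open>h\<close> is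
  only a left inverse of \<open>g\<close>, so \<open>g (h p)\<close> need not be
  \<open>p\<close>.\<close>

lemma funpow_conj:
  assumes closed: "\<And>p. p \<in> E \<Longrightarrow> g p \<in> E \<and> r p \<in> E \<and> h p \<in> E" and cancel: "\<And>p. p \<in> E \<Longrightarrow> h (g p) = p"
    and f: "\<And>p. p \<in> E \<Longrightarrow> f p = g (r (h p))" and p: "p \<in> E"
  shows "g ((r ^^ j) (h p)) = (if j = 0 then g (h p) else (f ^^ j) p) \<and> (r ^^ j) (h p) \<in> E"
proof (induction j)
  case 0
  then show ?case using closed p by simp
next
  case (Suc j)
  show ?case
  proof (cases "j = 0")
    case True
    then show ?thesis using closed p f by simp
  next
    case False
    then have IH: "(f ^^ j) p = g ((r ^^ j) (h p))" "(r ^^ j) (h p) \<in> E"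
      using Suc by auto
    then show ?thesis
      using closed f[of "g ((r ^^ j) (h p))"] cancel[of "(r ^^ j) (h p)"] by simp
  qed
qed

text \<open>A letter acts through its sign and the parity of its subscript, so \<open>r\<close> acts
  as the \<open>m\<close>-th power of a product of two letters. That product is a rotation of the
  \<open>m\<close> copies if the first letter is positive, and a conjugate of one by
  \<open>gen_act\<close> otherwise.\<close>

lemma foldr_letter_act_relator:
  assumes m: "m \<ge> 1" and p: "p \<in> {..<m} \<times> carrier (free_group {a, b})"
    and r: "map (\<lambda>(i, e). (even i, e)) r = concat (replicate m [(s, e), (\<not> s, \<not> e)])"
  shows "foldr (letter_act a b m) r p = p"
proof -
  let ?E = "{..<m} \<times> carrier (free_group {a, b})"
  \<comment> \<open>The subscripts 0 and 1 represent the two parity classes; \<open>True\<close>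
    stands for even.\<close>
  define par :: "bool \<times> bool \<Rightarrow> nat letter" where "par = (\<lambda>(s, e). (if s then 0 else 1, e))"
  define f where "f = letter_act a b m (par (s, e)) \<circ> letter_act a b m (par (\<not> s, \<not> e))"
  have par: "letter_act a b m (par (even i, e)) = letter_act a b m (i, e)" for i e
    by (auto simp: letter_act_def par_def)
  have "foldr (letter_act a b m) r p =
      foldr (letter_act a b m \<circ> par) (map (\<lambda>(i, e). (even i, e)) r) p"
    by (induction r) (auto simp: par)
  also have "\<dots> = (f ^^ m) p"
    unfolding r foldr_concat_replicate f_def by (simp add: comp_def)
  also have "\<dots> = p"
  proof -
    have closed: "gen_act a b e p \<in> ?E" "rot m e p \<in> ?E" if "p \<in> ?E" for e p
      using that by (auto intro: gen_act_closed rot_closed)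
    show ?thesis
    proof (cases e)
      case True
      have f_eq: "f p = rot m s p" if "p \<in> ?E" for p
        using closed[OF that] that
          gen_act_cancel[OF closed(2)[OF that, of True], of True]
          gen_act_cancel[OF that, of True] True
        by (cases s) (auto simp: f_def letter_act_def par_def)
      have "(f ^^ j) p = (rot m s ^^ j) p \<and> (rot m s ^^ j) p \<in> ?E" for j
      proof (induction j)
        case (Suc j)
        then show ?case using f_eq closed by simp
      qed (use p in simp)
      then show ?thesis
        using rot_funpow_self[OF p] by simp
    next
      case False
      have f_eq: "f p = gen_act a b False (rot m (\<not> s) (gen_act a b True p))" for p
        using False by (auto simp: f_def letter_act_def par_def)
      have cl: "gen_act a b False p \<in> ?E \<and> rot m (\<not> s) p \<in> ?E \<and> gen_act a b True p \<in> ?E" if "p \<in> ?E" for p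
        using closed that by blast
      have cancel: "gen_act a b True (gen_act a b False p) = p" if "p \<in> ?E" for p
        using gen_act_cancel[OF that, of True] by simp
      have "(f ^^ m) p = gen_act a b False ((rot m (\<not> s) ^^ m) (gen_act a b True p))"
        using funpow_conj[of ?E, OF cl cancel f_eq p, of m] m by simp
      also have "\<dots> = p"
        using rot_funpow_self[OF closed(1)[OF p], of "\<not> s" True] gen_act_cancel[OF p, of False] by simp
      finally show ?thesis .
    qed
  qed
  finally show ?thesis .
qed

section \<open>Reaching every element of copy 0, and largeness\<close>

lemma foldr_letter_act_surj:
  assumes "n \<ge> 2" "m \<ge> 2" and g: "g \<in> carrier (free_group {a, b})"
  shows "\<exists>v\<in>carrier (free_group {..<n}). foldr (letter_act a b m) v (0, []) = (0, g)"
proof -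
  let ?E = "{..<m} \<times> carrier (free_group {a, b})"
  let ?h = "\<lambda>v. restrict (foldr (letter_act a b m) v) ?E"
  have hom: "?h \<in> hom (free_group {..<n}) (BijGroup ?E)"
    by (intro free_group_hom_BijGroup letter_act_closed letter_act_cancel)
  have one: "(0, []) \<in> ?E"
    using assms by (auto simp: free_group_def)
  have mult: "foldr (letter_act a b m) (foldr lmult u v) p =
      foldr (letter_act a b m) u (foldr (letter_act a b m) v p)"
    if uv: "u \<in> carrier (free_group {..<n})" "v \<in> carrier (free_group {..<n})" and p: "p \<in> ?E" for u v p
  proof -
    have "?h (foldr lmult u v) p = (?h u \<otimes>\<^bsub>BijGroup ?E\<^esub> ?h v) p"
      using hom_mult[OF hom uv] by (simp add: free_group_def)
    moreover have "?h u \<in> Bij ?E" "?h v \<in> Bij ?E"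
      using hom_in_carrier[OF hom] uv by (auto simp: BijGroup_def)
    ultimately show ?thesis
      using p foldr_letter_act_closed[OF p] by (simp add: BijGroup_def compose_def)
  qed
  have F: "reduced g" "fst ` set g \<subseteq> {a, b}"
    using g by (auto simp: free_group_def)
  then show ?thesis
  proof (induction g)
    case Nil
    show ?case by (intro bexI[of _ "[]"]) (auto simp: free_group_def)
  next
    case (Cons l g)
    then obtain v where v: "v \<in> carrier (free_group {..<n})"
      "foldr (letter_act a b m) v (0, []) = (0, g)"
      by (auto simp: reduced_Cons)
    obtain x e where l: "l = (x, e)" by (cases l)
    \<comment> \<open>On copy 0, \<open>s\<close> multiplies by \<open>a\<close>. The conjugate of
      \<open>s\<close> by \<open>t\<close> passes to copy 1, where \<open>s\<close> multiplies by
      \<open>b\<close>, and returns; the factors of \<open>b\<close> contributed by \<open>t\<close>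
      and its inverse leave just \<open>b\<close> or its inverse.\<close>
    define u :: "nat word" where "u = (if x = a then [(0, e)] else [(1, True), (0, e), (1, False)])"
    have u: "u \<in> carrier (free_group {..<n})"
      using assms by (auto simp: u_def free_group_def reduced_Cons inv_letter_def)
    have "lmult l g = l # g"
      using Cons.prems by (simp add: lmult_reduced)
    moreover have "lmult (b, True) (lmult (b, e) (lmult (b, False) g)) = lmult (b, e) g"
      using lmult_lmult_inv[of g "(b, True)"] lmult_lmult_inv[of "lmult (b, False) g" "(b, True)"]
        Cons.prems by (cases e) (auto simp: reduced_Cons reduced_lmult inv_letter_def)
    ultimately have "foldr (letter_act a b m) u (0, g) = (0, l # g)"
      using Cons.prems assms(2)
      by (auto simp: u_def letter_act_def gen_act_def rot_def l)
    then show ?case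
      using mult[OF u v(1) one] v(2) monoid.m_closed[OF group.is_monoid[OF group_free_group] u v(1)]
      by (intro bexI[of _ "foldr lmult u v"])
         (simp_all add: free_group_def)
  qed
qed

lemma large_presented_group_if_parity_alternating:
  fixes P :: "nat presentation"
  assumes P: "is_presentation P" and X: "fst P = {..<n}" and "n \<ge> 2" "m \<ge> 2"
    and R: "\<And>r. r \<in> snd P \<Longrightarrow>
      \<exists>s e. map (\<lambda>(i, e). (even i, e)) r = concat (replicate m [(s, e), (\<not> s, \<not> e)])"
  shows "large (presented_group P)"
proof -
  \<comment> \<open>Any two distinct values would do; they have this type because
    \<open>large\<close> takes bases from the element type of the group.\<close>
  let ?a = "{} :: nat word set" and ?b = "{[]} :: nat word set"
  let ?F = "free_group {?a, ?b}"
  let ?E = "{..<m} \<times> carrier ?F"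
  let ?h = "\<lambda>v. restrict (foldr (letter_act ?a ?b m) v) ?E"
  let ?coset = "r_coset (free_group (fst P)) (normal_closure (free_group (fst P)) (snd P))"
  have hom: "?h \<in> hom (free_group (fst P)) (BijGroup ?E)"
    by (intro free_group_hom_BijGroup letter_act_closed letter_act_cancel)
  have relator: "?h r = \<one>\<^bsub>BijGroup ?E\<^esub>" if r: "r \<in> snd P" for r
  proof -
    obtain s e where "map (\<lambda>(i, e). (even i, e)) r = concat (replicate m [(s, e), (\<not> s, \<not> e)])"
      using R[OF r] by blast
    then show ?thesis
      using foldr_letter_act_relator[of m _ ?a ?b r s e] \<open>m \<ge> 2\<close> by (auto simp: BijGroup_def fun_eq_iff)
  qed
  obtain f where f: "f \<in> hom (presented_group P) (BijGroup ?E)"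
    and coset: "\<And>v. v \<in> carrier (free_group (fst P)) \<Longrightarrow> f (?coset v) = ?h v"
    using presented_group_hom[OF P group_BijGroup hom relator] by blast
  have carrier: "carrier (presented_group P) = ?coset ` carrier (free_group (fst P))"
    by (auto simp: presented_group_def FactGroup_def RCOSETS_def)
  show ?thesis
  proof (rule large_if_equivariant_action[of _ "{..<m}" 0 "{?a, ?b}" f])
    show "group (presented_group P)"
      using P by (rule group_presented_group)
    show "\<not> comm_group ?F"
      by (rule not_comm_free_group[of ?a _ ?b]) auto
    fix x c g h assume "x \<in> carrier (presented_group P)" and cgh: "c \<in> {..<m}" "g \<in> carrier ?F" "h \<in> carrier ?F"
    then obtain v where v: "v \<in> carrier (free_group (fst P))" "x = ?coset v"
      by (auto simp: carrier)
    have "g \<otimes>\<^bsub>?F\<^esub> h \<in> carrier ?F"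
      using cgh by (simp add: monoid.m_closed[OF group.is_monoid[OF group_free_group]])
    then show "f x (c, g \<otimes>\<^bsub>?F\<^esub> h) = (fst (f x (c, g)), snd (f x (c, g)) \<otimes>\<^bsub>?F\<^esub> h)"
      using coset[OF v(1)] v(2) cgh foldr_letter_act_mult[of c m g ?a ?b h v] by (simp add: free_group_def)
  next
    fix g assume g: "g \<in> carrier ?F"
    then obtain v where v: "v \<in> carrier (free_group {..<n})"
      "foldr (letter_act ?a ?b m) v (0, []) = (0, g)"
      using foldr_letter_act_surj[OF \<open>n \<ge> 2\<close> \<open>m \<ge> 2\<close> g] by (elim bexE)
    moreover have "(0, []) \<in> ?E"
      using \<open>m \<ge> 2\<close> by (simp add: free_group_def)
    ultimately have "f (?coset v) (0, \<one>\<^bsub>?F\<^esub>) = (0, g)"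
      using coset[of v] X by (simp add: free_group_def)
    then show "\<exists>x\<in>carrier (presented_group P). f x (0, \<one>\<^bsub>?F\<^esub>) = (0, g)"
      unfolding carrier using v(1) X by (intro bexI[of _ "?coset v"] imageI) simp_all
  qed (use f \<open>m \<ge> 2\<close> in auto)
qed

section \<open>Shift-invariant graphs\<close>

text \<open>Division with remainder by the least positive element, which exists because of
  \<open>int n\<close>.\<close>

lemma int_subgroup_eq_multiples:
  fixes I :: "int set"
  assumes diff: "\<And>x y. x \<in> I \<Longrightarrow> y \<in> I \<Longrightarrow> x - y \<in> I" and n: "int n \<in> I" "n > 0"
  obtains d :: nat where "d > 0" "I = {z. int d dvd z}"
proof -
  define d where "d = (LEAST d. d > 0 \<and> int d \<in> I)"
  have d: "d > 0" "int d \<in> I"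
    using LeastI[of "\<lambda>d. d > 0 \<and> int d \<in> I" n] n by (auto simp: d_def)
  have zero: "0 \<in> I"
    using diff[OF n(1) n(1)] by simp
  have neg: "- x \<in> I" if "x \<in> I" for x
    using diff[OF zero that] by simp
  have add: "x + y \<in> I" if "x \<in> I" "y \<in> I" for x y
    using diff[OF that(1) neg[OF that(2)]] by simp
  have mult_nat: "int j * int d \<in> I" for j
    by (induction j) (use zero add d(2) in \<open>auto simp: algebra_simps\<close>)
  have mult: "z * int d \<in> I" for z
  proof (cases "z \<ge> 0")
    case True
    then show ?thesis using mult_nat[of "nat z"] by simp
  next
    case False
    then show ?thesis using neg[OF mult_nat[of "nat (- z)"]] by simp
  qed
  have "int d dvd z" if z: "z \<in> I" for z
  proof (rule ccontr)
    assume nd: "\<not> int d dvd z"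
    have "z - (z div int d) * int d \<in> I"
      using diff[OF z mult] by simp
    then have "z mod int d \<in> I"
      by (simp add: minus_div_mult_eq_mod)
    moreover have "z mod int d > 0" "z mod int d < int d"
      using nd d(1) by (simp_all add: dvd_eq_mod_eq_0 order.not_eq_order_implies_strict)
    ultimately have "nat (z mod int d) > 0 \<and> int (nat (z mod int d)) \<in> I" "nat (z mod int d) < d"
      by auto
    then show False
      using not_less_Least[of "nat (z mod int d)" "\<lambda>d. d > 0 \<and> int d \<in> I"] by (simp add: d_def)
  qed
  then have "I = {z. int d dvd z}"
    using mult by (auto simp: dvd_def mult.commute)
  then show thesis using that d(1) by blast
qed

lemma card_multiples_less:
  assumes "d > 0" "d dvd n"
  shows "card {i. i < n \<and> d dvd i} = n div d"
proof -
  have "{i. i < n \<and> d dvd i} = (\<lambda>j. d * j) ` {..<n div d}"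
    using assms by (auto elim!: dvdE)
  moreover have "inj_on (\<lambda>j. d * j) {..<n div d}"
    using assms by (auto simp: inj_on_def)
  ultimately show ?thesis
    by (simp add: card_image)
qed

section \<open>Connectivity in multigraphs\<close>

definition adj :: "('v, 'e) multigraph \<Rightarrow> 'v \<Rightarrow> 'v \<Rightarrow> bool" where
  "adj G u v \<longleftrightarrow> (\<exists>e\<in>edges G. ends G e = {u, v})"

definition joined :: "('v, 'e) multigraph \<Rightarrow> 'v \<Rightarrow> 'v \<Rightarrow> bool" where
  "joined G u v \<longleftrightarrow> (\<exists>p. walk G u p v)"

lemma adj_sym: "adj G u v \<Longrightarrow> adj G v u"
  by (auto simp: adj_def insert_commute)

lemma joined_refl: "v \<in> verts G \<Longrightarrow> joined G v v"
  unfolding joined_def using walk.intros(1) by metis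

lemma joined_step: "u \<in> verts G \<Longrightarrow> adj G u v \<Longrightarrow> joined G v w \<Longrightarrow> joined G u w"
  unfolding joined_def adj_def using walk.intros(2) by metis

lemma joined_verts:
  assumes "joined G u v" shows "u \<in> verts G \<and> v \<in> verts G"
proof -
  obtain p where "walk G u p v" using assms by (auto simp: joined_def)
  then show ?thesis by induction auto
qed

lemma joined_induct [consumes 1, case_names refl step]:
  assumes "joined G u w"
    and "\<And>v. v \<in> verts G \<Longrightarrow> P v v"
    and "\<And>u v w. u \<in> verts G \<Longrightarrow> adj G u v \<Longrightarrow> joined G v w \<Longrightarrow> P v w \<Longrightarrow> P u w"
  shows "P u w"
proof -
  obtain p where "walk G u p w" using assms(1) by (auto simp: joined_def)
  then show ?thesis
  proof induction
    case (2 u e v p w)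
    show ?case
      by (rule assms(3)[of u v]) (use 2 in \<open>auto simp: adj_def joined_def\<close>)
  qed (rule assms(2))
qed

lemma joined_trans:
  assumes "joined G u v" "joined G v w"
  shows "joined G u w"
  using assms
proof (induction rule: joined_induct)
  case (step u v w)
  then show ?case by (meson joined_step)
qed

lemma joined_sym:
  assumes "joined G u v"
  shows "joined G v u"
  using assms
proof (induction rule: joined_induct)
  case (step u v w)
  have "v \<in> verts G"
    using joined_verts[OF step(3)] by simp
  then have "joined G v u"
    by (rule joined_step[OF _ adj_sym[OF step(2)] joined_refl[OF step(1)]])
  with step(4) show ?case by (rule joined_trans)
qed (rule joined_refl)

section \<open>Components and colourings of shift-invariant graphs\<close>

lemma shift_invariant_joined:
  fixes G :: "(nat \<times> bool, 'e) multigraph"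
  assumes verts: "verts G = {..<n} \<times> UNIV" and n: "n > 0"
    and shift: "\<And>i e j f c. adj G (i, e) (j, f) \<Longrightarrow> adj G ((i + c) mod n, e) ((j + c) mod n, f)"
    and "joined G u v"
  shows "joined G ((fst u + c) mod n, snd u) ((fst v + c) mod n, snd v)"
  using assms(4)
proof (induction rule: joined_induct)
  case (refl v)
  have "((fst v + c) mod n, snd v) \<in> verts G"
    using n verts by simp
  then show ?case by (rule joined_refl)
next
  case (step u v w)
  have "adj G ((fst u + c) mod n, snd u) ((fst v + c) mod n, snd v)"
    using shift step(2) by simp
  moreover have "((fst u + c) mod n, snd u) \<in> verts G"
    using n verts by simp
  ultimately show ?case using step(4) joined_step by metis
qed

text \<open>Shift invariance is stated for natural shifts only; translating back by \<open>i\<close>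
  is therefore a shift by \<open>n - i\<close>.\<close>

lemma nat_mod_diff:
  assumes "i < n"
  shows "nat ((z - int i) mod int n) = (nat (z mod int n) + (n - i)) mod n"
proof -
  have "int ((nat (z mod int n) + (n - i)) mod n) = (z mod int n + (int n - int i)) mod int n"
    using assms by (simp add: of_nat_mod of_nat_diff algebra_simps)
  also have "\<dots> = (z - int i) mod int n"
    by (metis (no_types, opaque_lifting) add.commute diff_add_eq mod_add_left_eq mod_add_self2 add_diff_eq)
  finally show ?thesis
    by (metis nat_int)
qed

text \<open>Walks can be translated, so the subscripts joined to 0, lifted to the integers, are
  closed under differences. They contain \<open>n\<close> and hence are the multiples of some
  divisor \<open>d\<close> of \<open>n\<close>. Translating a walk so that it starts at 0 gives the
  congruence for arbitrary ends.\<close>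

lemma joined_classes:
  fixes G :: "(nat \<times> bool, 'e) multigraph"
  assumes verts: "verts G = {..<n} \<times> UNIV" and n: "n > 0"
    and sign: "\<And>u v. adj G u v \<Longrightarrow> snd u = snd v"
    and shift: "\<And>i e j f c. adj G (i, e) (j, f) \<Longrightarrow> adj G ((i + c) mod n, e) ((j + c) mod n, f)"
  obtains d where "d > 0" "d dvd n" "{v. joined G (0, e) v} = {i. i < n \<and> d dvd i} \<times> {e}"
    "\<And>i j. joined G (i, e) (j, e) \<Longrightarrow> int d dvd int i - int j"
proof -
  have sh: "joined G ((fst u + c) mod n, snd u) ((fst v + c) mod n, snd v)" if "joined G u v" for u v c
    by (rule shift_invariant_joined[OF verts n _ that]) (rule shift)
  have snd_eq: "snd u = snd v" if "joined G u v" for u v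
    using that by (induction rule: joined_induct) (auto dest: sign)
  define I where "I = {z::int. joined G (0, e) (nat (z mod int n), e)}"
  have diffI: "x - int i \<in> I" if "joined G (i, e) (nat (x mod int n), e)" for x i
  proof -
    have i: "i < n" using joined_verts[OF that] verts by auto
    have "joined G ((i + (n - i)) mod n, e) ((nat (x mod int n) + (n - i)) mod n, e)"
      using sh[OF that, of "n - i"] by simp
    then show ?thesis
      using i nat_mod_diff[OF i, of x] by (simp add: I_def)
  qed
  have "x - y \<in> I" if "x \<in> I" "y \<in> I" for x y
  proof -
    have "joined G (nat (y mod int n), e) (nat (x mod int n), e)"
      using that joined_trans[OF joined_sym] by (simp add: I_def)
    then have "x - int (nat (y mod int n)) \<in> I"
      by (rule diffI)
    then show ?thesis
      using n by (simp add: I_def mod_diff_right_eq)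
  qed
  moreover have nI: "int n \<in> I"
    using n verts by (simp add: I_def joined_refl)
  ultimately obtain d where d: "d > 0" "I = {z. int d dvd z}"
    using int_subgroup_eq_multiples[of I n] n by blast
  have "joined G (0, e) v \<longleftrightarrow> fst v < n \<and> d dvd fst v \<and> snd v = e" for v
  proof (cases "snd v = e \<and> fst v < n")
    case True
    then have "joined G (0, e) v \<longleftrightarrow> int (fst v) \<in> I"
      by (cases v) (auto simp: I_def)
    with True show ?thesis by (simp add: d)
  next
    case False
    then have "\<not> joined G (0, e) v"
      using snd_eq[of "(0, e)" v] joined_verts[of G "(0, e)" v] verts by (cases v) auto
    with False show ?thesis by blast
  qed
  then have "{v. joined G (0, e) v} = {i. i < n \<and> d dvd i} \<times> {e}"
    by auto
  moreover have "int d dvd int i - int j" if "joined G (i, e) (j, e)" for i j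
  proof -
    have "j < n" using joined_verts[OF that] verts by auto
    then have "int j - int i \<in> I"
      using diffI[of i "int j"] that by simp
    then show ?thesis
      by (simp add: d dvd_diff_commute)
  qed
  ultimately show thesis
    using that d nI by auto
qed

text \<open>The shift of a connected bipartite shift-invariant graph on \<open>{..<n}\<close> is transitive on
  vertices, so it must exchange the two colour classes: the colour of \<open>i\<close> is the parity of \<open>i\<close>.\<close>

lemma bipartite_parity:
  fixes G :: "(nat \<times> bool, 'e) multigraph"
  assumes verts: "verts G = {..<n} \<times> UNIV" and n: "n > 0"
    and sign: "\<And>u v. adj G u v \<Longrightarrow> snd u = snd v"
    and shift: "\<And>i e j f c. adj G (i, e) (j, f) \<Longrightarrow> adj G ((i + c) mod n, e) ((j + c) mod n, f)"
    and joined: "{v. joined G (0, e) v} = {..<n} \<times> {e}"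
    and bipartite: "bipartite_graph (induced G ({..<n} \<times> {e}))"
    and adj: "adj G (i, e) (j, e)" and "i < n" "j < n"
  shows "even n \<and> even i \<noteq> even j"
proof -
  obtain A B where AB: "A \<inter> B = {}" "\<And>f. f \<in> edges G \<Longrightarrow> ends G f \<subseteq> {..<n} \<times> {e} \<Longrightarrow>
      \<exists>a\<in>A. \<exists>b\<in>B. ends G f = {a, b}"
    using bipartite by (auto simp: bipartite_graph_def induced_def)
  \<comment> \<open>The colouring as a function on the integers, periodic modulo \<open>n\<close>,
    so that translations need no reduction.\<close>
  define c where "c = (\<lambda>z. (nat (z mod int n), e) \<in> A)"
  have periodic: "c z = c z'" if "z mod int n = z' mod int n" for z z'
    using that by (simp add: c_def)
  \<comment> \<open>Every translate of an edge is an edge and so has ends of different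
    colours.\<close>
  have step: "c (z + int v) = (\<not> c (z + int u))" if uv: "adj G (u, e) (v, e)" for u v z
  proof -
    let ?z = "nat (z mod int n)"
    have nat: "nat ((z + int u) mod int n) = (u + ?z) mod n" for u
    proof -
      have "int ((u + ?z) mod n) = (z + int u) mod int n"
        using n by (simp add: of_nat_mod mod_simps add.commute)
      then show ?thesis by (metis nat_int)
    qed
    obtain f where f: "f \<in> edges G" "ends G f = {((u + ?z) mod n, e), ((v + ?z) mod n, e)}"
      using shift[OF uv, of ?z] by (auto simp: adj_def)
    then obtain a b where "a \<in> A" "b \<in> B" "{((u + ?z) mod n, e), ((v + ?z) mod n, e)} = {a, b}"
      using AB(2)[of f] n by auto
    then show ?thesis
      using AB(1) unfolding c_def nat by (auto simp: doubleton_eq_iff)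
  qed
  \<comment> \<open>\<open>K z\<close> says that translation by \<open>z\<close> respects the
    colouring, either preserving all colours or exchanging them. Along an edge it exchanges them, so
    along a walk one of the two happens.\<close>
  define K where "K = (\<lambda>z. (\<forall>x. c (x + z) = c x) \<or> (\<forall>x. c (x + z) = (\<not> c x)))"
  have key: "snd u = e \<longrightarrow> K (int (fst v) - int (fst u))" if "joined G u v" for u v
    using that
  proof (induction rule: joined_induct)
    case (refl v)
    then show ?case by (simp add: K_def)
  next
    case (step u v w)
    show ?case
    proof
      assume e: "snd u = e"
      then have v: "snd v = e" using sign[OF step(2)] by simp
      have flip: "c (x + (int (fst v) - int (fst u))) = (\<not> c x)" for x
        using \<open>\<And>z v u. adj G (u, e) (v, e) \<Longrightarrow> c (z + int v) = (\<not> c (z + int u))\<close>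
          [of "fst u" "fst v" "x - int (fst u)"] step(2) e v by (cases u; cases v) (simp add: algebra_simps)
      have K: "K (int (fst w) - int (fst v))"
        using step v by simp
      have "c (x + (int (fst w) - int (fst u))) =
          c ((x + (int (fst v) - int (fst u))) + (int (fst w) - int (fst v)))" for x
        by (simp add: algebra_simps)
      then show "K (int (fst w) - int (fst u))"
        using K flip unfolding K_def by metis
    qed
  qed
  \<comment> \<open>Connectedness supplies a walk from 0 to 1, hence \<open>K 1\<close>; writing
    \<open>1 mod n\<close> also covers \<open>n = 1\<close>.\<close>
  have "(1 mod n, e) \<in> {v. joined G (0, e) v}"
    unfolding joined using n by simp
  then have "joined G (0, e) (1 mod n, e)"
    by simp
  from key[OF this] have "K (int (1 mod n))"
    by simp
  moreover have "c (x + int (1 mod n)) = c (x + 1)" for x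
    by (rule periodic) (simp add: of_nat_mod mod_simps)
  ultimately have "(\<forall>x. c (x + 1) = c x) \<or> (\<forall>x. c (x + 1) = (\<not> c x))"
    by (simp add: K_def)
  moreover have ij: "c (int j) = (\<not> c (int i))"
    using step[OF adj, of 0] by simp
  \<comment> \<open>If translation by 1 preserved colours, \<open>c\<close> would be constant on the
    subscripts, against the edge from \<open>i\<close> to \<open>j\<close>.\<close>
  moreover have "c (int k) = c 0" if "\<forall>x. c (x + 1) = c x" for k
  proof (induction k)
    case (Suc k)
    then show ?case using that[rule_format, of "int k"] by (simp add: add.commute)
  qed simp
  ultimately have flip: "c (x + 1) = (\<not> c x)" for x
    by blast
  have parity: "c (int k) = (c 0 = even k)" for k
  proof (induction k)
    case (Suc k)
    then show ?case using flip[of "int k"] by (auto simp: add.commute)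
  qed simp
  \<comment> \<open>Periodicity of a colouring by parity forces \<open>n\<close> to be even.\<close>
  have "c (int n) = c 0"
    by (rule periodic) simp
  then show ?thesis
    using parity[of n] parity[of i] parity[of j] ij by auto
qed

section \<open>Star graphs of alternating cyclic presentations\<close>

text \<open>The even length makes the pattern close up cyclically, so that it survives
  rotation.\<close>

definition sign_alternating :: "'a word \<Rightarrow> bool" where
  "sign_alternating w \<longleftrightarrow> even (length w) \<and> (\<exists>s. \<forall>i<length w. snd (w ! i) = (even i = s))"

lemma rotate_eq_adjacent:
  assumes "j < length w" "length w \<ge> 2"
  obtains t where "rotate j w = w ! j # w ! (Suc j mod length w) # t"
proof -
  have "length (rotate j w) \<ge> Suc (Suc 0)"
    using assms by simp
  then obtain x y t where xyt: "rotate j w = x # y # t"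
    by (metis Suc_le_length_iff)
  then have "x = rotate j w ! 0" "y = rotate j w ! 1"
    by simp_all
  then have "x = w ! j" "y = w ! (Suc j mod length w)"
    using assms nth_rotate[of 0 w j] nth_rotate[of 1 w j] by force+
  with xyt that show thesis
    by blast
qed

text \<open>Cyclic neighbours with equal signs would form a forbidden subword. The pair of the last
  and the first letter then forces even length.\<close>

lemma sign_alternating_if_alternating:
  assumes "alternating w" "length w \<ge> 2"
  shows "sign_alternating w"
proof -
  have flip: "snd (w ! (Suc j mod length w)) = (\<not> snd (w ! j))" if j: "j < length w" for j
  proof -
    obtain t where t: "rotate j w = [w ! j, w ! (Suc j mod length w)] @ t"
      using rotate_eq_adjacent[OF j assms(2)] by auto
    have "rotate j w \<in> cyclic_perms w"
      unfolding cyclic_perms_def by blast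
    with t have "cyclic_subword [w ! j, w ! (Suc j mod length w)] w"
      unfolding cyclic_subword_def by blast
    moreover have "\<not> cyclic_subword [(i, True), (i', True)] w"
      "\<not> cyclic_subword [(i, False), (i', False)] w" for i i'
      using assms(1) by (auto simp: alternating_def inv_word_def inv_letter_def)
    ultimately show ?thesis
      by (cases "w ! j"; cases "w ! (Suc j mod length w)"; cases "snd (w ! j)";
          cases "snd (w ! (Suc j mod length w))") auto
  qed
  have sign: "snd (w ! j) = (even j = snd (w ! 0))" if "j < length w" for j
    using that
  proof (induction j)
    case (Suc j)
    then have "Suc j mod length w = Suc j" "j < length w"
      by simp_all
    then show ?case
      using flip[of j] Suc.IH by auto
  qed simp
  have "length w - 1 < length w" "Suc (length w - 1) = length w"
    using assms(2) by linarith+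
  then have "snd (w ! 0) = (\<not> snd (w ! (length w - 1)))"
    using flip[of "length w - 1"] by simp
  then have "odd (length w - 1)"
    using sign[OF \<open>length w - 1 < length w\<close>] by blast
  then have "even (length w)"
    by simp
  then show ?thesis
    using sign unfolding sign_alternating_def by blast
qed

lemma sign_alternating_rotate:
  assumes "sign_alternating w" shows "sign_alternating (rotate j w)"
proof -
  obtain s where s: "\<And>i. i < length w \<Longrightarrow> snd (w ! i) = (even i = s)" and e: "even (length w)"
    using assms by (auto simp: sign_alternating_def)
  have "snd (rotate j w ! i) = (even i = (even j = s))" if "i < length w" for i
  proof -
    have "(j + i) mod length w < length w"
      by (rule mod_less_divisor) (use that in auto)
    moreover have "even ((j + i) mod length w) = even (j + i)"
      using e by (simp add: dvd_mod_iff)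
    ultimately show ?thesis
      using s[of "(j + i) mod length w"] that by (auto simp: nth_rotate add.commute)
  qed
  then show ?thesis
    using e unfolding sign_alternating_def by auto
qed

text \<open>Reversing a word of even length flips the sign pattern, and inverting the letters flips
  it back.\<close>

lemma sign_alternating_inv_word:
  assumes "sign_alternating w" shows "sign_alternating (inv_word w)"
proof -
  obtain s where s: "\<And>i. i < length w \<Longrightarrow> snd (w ! i) = (even i = s)" and e: "even (length w)"
    using assms by (auto simp: sign_alternating_def)
  have "snd (inv_word w ! i) = (even i = s)" if "i < length w" for i
    using s[of "length w - Suc i"] that e by (auto simp: inv_word_def rev_nth inv_letter_def)
  then show ?thesis
    using e unfolding sign_alternating_def by (auto simp: inv_word_def)
qed

section \<open>Shifts and the relator closure\<close>

definition shift_by :: "nat \<Rightarrow> nat \<Rightarrow> nat word \<Rightarrow> nat word" where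
  "shift_by n c w = map (\<lambda>(i, e). ((i + c) mod n, e)) w"

lemma shift_by_shift_by: "shift_by n c (shift_by n d w) = shift_by n (d + c) w"
  by (auto simp: shift_by_def mod_simps algebra_simps)

lemma shift_by_mod: "shift_by n (c mod n) w = shift_by n c w"
  by (simp add: shift_by_def mod_simps)

text \<open>The bound on subscripts matters at \<open>j = 0\<close>, where \<open>shift_by\<close>
  still reduces them modulo \<open>n\<close>.\<close>

lemma funpow_shift:
  assumes "fst ` set w \<subseteq> {..<n}"
  shows "(shift n ^^ j) w = shift_by n j w"
proof (induction j)
  case 0
  have "map (\<lambda>(i, e). (i mod n, e)) w = map (\<lambda>x. x) w"
    using assms by (intro map_cong) auto
  then show ?case by (simp add: shift_by_def)
next
  case (Suc j)
  have "shift n = shift_by n 1"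
    by (simp add: fun_eq_iff shift_def shift_by_def)
  then show ?case using Suc by (simp add: shift_by_shift_by)
qed

lemma relators_cyclic_presentation:
  assumes "fst ` set w \<subseteq> {..<n}" "n > 0"
  shows "snd (cyclic_presentation n w) = range (\<lambda>j. shift_by n j w)"
proof -
  have "shift_by n j w \<in> {shift_by n j w | j. j < n}" for j
    using shift_by_mod[of n j w] assms(2) by (metis (mono_tags, lifting) mem_Collect_eq mod_less_divisor)
  then show ?thesis
    using funpow_shift[OF assms(1)] by (auto simp: cyclic_presentation_def)
qed

lemma shift_by_rotate: "shift_by n c (rotate j w) = rotate j (shift_by n c w)"
  by (simp add: shift_by_def rotate_map)

lemma shift_by_inv_word: "shift_by n c (inv_word w) = inv_word (shift_by n c w)"
  by (auto simp: shift_by_def inv_word_def inv_letter_def rev_map)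

lemma sign_alternating_shift_by: "sign_alternating w \<Longrightarrow> sign_alternating (shift_by n c w)"
  by (simp add: sign_alternating_def shift_by_def case_prod_beta)

text \<open>The two words of an edge begin with \<open>x\<close> and \<open>y\<close> respectively,
  so they contribute exactly these two ends.\<close>

lemma adj_star_graph:
  "adj (star_graph P) u v \<longleftrightarrow>
    (\<exists>x y t. x # inv_letter y # t \<in> relator_closure P \<and> {u, v} = {x, y})"
proof -
  have ends: "ends (star_graph P) {x # inv_letter y # t, y # inv_letter x # inv_word t} = {x, y}"
    for x y :: "'a letter" and t
  proof -
    have "(\<exists>y' t'. z # inv_letter y' # t' \<in> {x # inv_letter y # t, y # inv_letter x # inv_word t})
        \<longleftrightarrow> z = x \<or> z = y" for z
      by blast
    then show ?thesis
      by (simp add: star_graph_def set_eq_iff)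
  qed
  have edges: "e \<in> edges (star_graph P) \<longleftrightarrow>
      (\<exists>x y t. e = {x # inv_letter y # t, y # inv_letter x # inv_word t} \<and>
        x # inv_letter y # t \<in> relator_closure P)" for e
    by (auto simp: star_graph_def)
  show ?thesis
  proof
    assume "adj (star_graph P) u v"
    then obtain e where "e \<in> edges (star_graph P)" "ends (star_graph P) e = {u, v}"
      by (auto simp: adj_def)
    then show "\<exists>x y t. x # inv_letter y # t \<in> relator_closure P \<and> {u, v} = {x, y}"
      using edges ends by metis
  next
    assume "\<exists>x y t. x # inv_letter y # t \<in> relator_closure P \<and> {u, v} = {x, y}"
    then show "adj (star_graph P) u v"
      using edges ends unfolding adj_def by metis
  qed
qed

text \<open>Inversion commutes with shifts, so every element of the closure is a rotated shift of
  \<open>w\<close> or its inverse; this form shows invariance under shifts.\<close>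

lemma relator_closure_cyclic_presentation:
  assumes "fst ` set w \<subseteq> {..<n}" "n > 0"
  shows "relator_closure (cyclic_presentation n w) =
    {rotate i (shift_by n j v) | i j v. v = w \<or> v = inv_word w}"
proof -
  have "inv_word ` range (\<lambda>j. shift_by n j w) = range (\<lambda>j. shift_by n j (inv_word w))"
    by (simp add: image_image shift_by_inv_word)
  then have eq: "range (\<lambda>j. shift_by n j w) \<union> inv_word ` range (\<lambda>j. shift_by n j w) =
      {shift_by n j v | j v. v = w \<or> v = inv_word w}"
    by blast
  show ?thesis
    unfolding relator_closure_def cyclic_perms_def relators_cyclic_presentation[OF assms] eq by blast
qed

lemma sign_alternating_relator_closure:
  assumes "fst ` set w \<subseteq> {..<n}" "n > 0" "sign_alternating w"
    and "q \<in> relator_closure (cyclic_presentation n w)"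
  shows "sign_alternating q"
proof -
  obtain i j v where q: "q = rotate i (shift_by n j v)" "v = w \<or> v = inv_word w"
    using assms(4) unfolding relator_closure_cyclic_presentation[OF assms(1,2)] by blast
  then have "sign_alternating v"
    using assms(3) sign_alternating_inv_word by blast
  then show ?thesis
    unfolding q(1) by (intro sign_alternating_rotate sign_alternating_shift_by)
qed

lemma shift_by_relator_closure:
  assumes "fst ` set w \<subseteq> {..<n}" "n > 0"
    and "q \<in> relator_closure (cyclic_presentation n w)"
  shows "shift_by n c q \<in> relator_closure (cyclic_presentation n w)"
proof -
  obtain i j v where q: "q = rotate i (shift_by n j v)" "v = w \<or> v = inv_word w"
    using assms(3) unfolding relator_closure_cyclic_presentation[OF assms(1,2)] by blast
  then have "shift_by n c q = rotate i (shift_by n (j + c) v)"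
    by (simp add: shift_by_rotate shift_by_shift_by)
  then show ?thesis
    using q(2) unfolding relator_closure_cyclic_presentation[OF assms(1,2)] by blast
qed

lemma concat_replicate_pair:
  assumes "length l = 2 * m" "\<And>i. i < length l \<Longrightarrow> l ! i = (if even i then a else b)"
  shows "l = concat (replicate m [a, b])"
  using assms
proof (induction m arbitrary: l)
  case 0
  from 0(1) show ?case by simp
next
  case (Suc m)
  from Suc.prems(1) obtain x y l' where l: "l = x # y # l'" "length l' = 2 * m"
    by (auto simp: length_Suc_conv)
  have "x = a" "y = b"
    using Suc.prems(2)[of 0] Suc.prems(2)[of 1] l by simp_all
  moreover have "l' ! i = (if even i then a else b)" if "i < length l'" for i
    using Suc.prems(2)[of "Suc (Suc i)"] l that by simp
  ultimately show ?case
    using Suc.IH[of l'] l by simp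
qed

section \<open>From the special presentation to parity-alternating relators\<close>

theorem corollary6p3:
  fixes n \<nu> k :: nat and w :: "nat word"
  assumes "n \<ge> 1" and "\<nu> \<ge> 1" and "k \<ge> 4"
    and "w \<in> carrier (free_group {..<n})" and "cyclically_reduced w"
    and "0 \<in> fst ` set w"
    and "non_redundant (cyclic_presentation n w)"
    and "irreducible_cyclic_presentation n w"
    and "special 2 k \<nu> (cyclic_presentation n w)"
    and "alternating w" and "length w \<ge> 4"
  shows "large (cyclically_presented_group n w)"
proof -
  let ?P = "cyclic_presentation n w"
  let ?G = "star_graph ?P"
  have n: "n > 0" and len: "length w \<ge> 2"
    using assms by simp_all
  have w: "fst ` set w \<subseteq> {..<n}"
    using assms(4) by (simp add: free_group_def)
  have alt: "sign_alternating w"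
    using assms(10) len by (rule sign_alternating_if_alternating)
  have verts: "verts ?G = {..<n} \<times> UNIV"
    by (simp add: star_graph_def cyclic_presentation_def)
  \<comment> \<open>The word of an edge begins with \<open>x\<close> and the inverse of
    \<open>y\<close>; these have opposite signs, so \<open>x\<close> and \<open>y\<close> have equal
    signs.\<close>
  have sign: "snd u = snd v" if uv: "adj ?G u v" for u v
  proof -
    obtain x y t where q: "x # inv_letter y # t \<in> relator_closure ?P" "{u, v} = {x, y}"
      using uv unfolding adj_star_graph by blast
    obtain s where s: "\<And>i. i < length (x # inv_letter y # t) \<Longrightarrow> snd ((x # inv_letter y # t) ! i) = (even i = s)"
      using sign_alternating_relator_closure[OF w n alt q(1)] unfolding sign_alternating_def by blast
    have "snd x = s" "snd y = s"
      using s[of 0] s[of 1] by (auto simp: inv_letter_def)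
    then show ?thesis
      using q(2) by (auto simp: doubleton_eq_iff)
  qed
  have shift: "adj ?G ((i + c) mod n, e) ((j + c) mod n, f)" if ij: "adj ?G (i, e) (j, f)" for i e j f c
  proof -
    let ?s = "\<lambda>(i, e). ((i + c) mod n, e)"
    obtain x y t where q: "x # inv_letter y # t \<in> relator_closure ?P" "{(i, e), (j, f)} = {x, y}"
      using ij unfolding adj_star_graph by blast
    have "?s x # inv_letter (?s y) # shift_by n c t = shift_by n c (x # inv_letter y # t)"
      by (auto simp: shift_by_def inv_letter_def split: prod.split)
    then have "?s x # inv_letter (?s y) # shift_by n c t \<in> relator_closure ?P"
      using shift_by_relator_closure[OF w n q(1)] by simp
    moreover have "{?s (i, e), ?s (j, f)} = {?s x, ?s y}"
      using q(2) by (auto simp: doubleton_eq_iff)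
    ultimately show ?thesis
      unfolding adj_star_graph prod.case by blast
  qed
  have comps: "induced ?G {v. joined ?G (0, e) v} \<in> components ?G" for e
    using n by (auto simp: components_def joined_def verts)
  have "\<exists>d. d > 0 \<and> d dvd n \<and> {v. joined ?G (0, e) v} = {i. i < n \<and> d dvd i} \<times> {e} \<and>
      (\<forall>i j. joined ?G (i, e) (j, e) \<longrightarrow> int d dvd int i - int j)" for e
    by (rule joined_classes[OF verts n sign shift, of e]) blast+
  from choice[OF allI[OF this]] obtain d where all: "\<forall>e. d e > 0 \<and> d e dvd n \<and>
      {v. joined ?G (0, e) v} = {i. i < n \<and> d e dvd i} \<times> {e} \<and>
      (\<forall>i j. joined ?G (i, e) (j, e) \<longrightarrow> int (d e) dvd int i - int j)" ..
  have d: "d e > 0" "d e dvd n" "{v. joined ?G (0, e) v} = {i. i < n \<and> d e dvd i} \<times> {e}"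
    "joined ?G (i, e) (j, e) \<Longrightarrow> int (d e) dvd int i - int j" for e i j
    using all[rule_format, of e] by simp_all
  \<comment> \<open>Isomorphic components have equally many vertices, here \<open>n div d e\<close>,
    so the divisors for the two signs agree.\<close>
  have "card {v. joined ?G (0, True) v} = card {v. joined ?G (0, False) v}"
  proof -
    have "isomorphic_graphs (induced ?G {v. joined ?G (0, True) v}) (induced ?G {v. joined ?G (0, False) v})"
      using assms(9) comps unfolding special_def by blast
    then show ?thesis
      by (auto simp: isomorphic_graphs_def induced_def intro: bij_betw_same_card)
  qed
  then have "n div d True = n div d False"
    using d(1,2) by (simp add: d(3) card_cartesian_product card_multiples_less)
  then have "d True * (n div d True) = d False * (n div d True)"
    using d(2) by (metis dvd_mult_div_cancel)
  moreover have "n div d True \<noteq> 0"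
    using d(1,2)[of True] n by (simp add: dvd_div_eq_0_iff)
  ultimately have d_eq: "d e = d True" for e
    by (cases e) simp_all
  have edge: "adj ?G (w ! j) (inv_letter (w ! (Suc j mod length w)))" if j: "j < length w" for j
  proof -
    obtain t where "rotate j w = w ! j # w ! (Suc j mod length w) # t"
      using rotate_eq_adjacent[OF j len] .
    moreover have "shift_by n 0 w = w"
      using funpow_shift[OF w, of 0] by simp
    moreover have "rotate j (shift_by n 0 w) \<in> relator_closure ?P"
      unfolding relator_closure_cyclic_presentation[OF w n] by blast
    ultimately have "w ! j # w ! (Suc j mod length w) # t \<in> relator_closure ?P"
      by simp
    then show ?thesis
      unfolding adj_star_graph by (metis inv_letter_inv_letter)
  qed
  define x where "x = (\<lambda>j. fst (w ! j))"
  have x_less: "x j < n" if "j < length w" for j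
    using w nth_mem[OF that] by (auto simp: x_def)
  \<comment> \<open>As signs alternate, inverting the next letter gives it the sign of
    \<open>w ! j\<close>: consecutive subscripts are adjacent within one sign.\<close>
  have edge': "adj ?G (x j, snd (w ! j)) (x (Suc j mod length w), snd (w ! j))" if "j < length w" for j
    using edge[OF that] sign[OF edge[OF that]] by (cases "w ! j") (auto simp: x_def inv_letter_def)
  have suc: "Suc j mod length w < length w" for j
    by (rule mod_less_divisor) (use len in linarith)
  have congruent: "int (d True) dvd int (x j) - int (x 0)" if "j < length w" for j
    using that
  proof (induction j)
    case (Suc j)
    then have j: "j < length w" "Suc j mod length w = Suc j"
      by simp_all
    have "joined ?G (x (Suc j), snd (w ! j)) (x (Suc j), snd (w ! j))"
      using x_less[OF Suc.prems] by (intro joined_refl) (simp add: verts)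
    moreover have "adj ?G (x j, snd (w ! j)) (x (Suc j), snd (w ! j))"
      using edge'[OF j(1)] unfolding j(2) .
    moreover have "(x j, snd (w ! j)) \<in> verts ?G"
      using x_less[OF j(1)] by (simp add: verts)
    ultimately have "joined ?G (x j, snd (w ! j)) (x (Suc j), snd (w ! j))"
      using joined_step by metis
    then have "int (d True) dvd int (x j) - int (x (Suc j))"
      using d(4) d_eq by metis
    then have "int (d True) dvd (int (x j) - int (x 0)) - (int (x j) - int (x (Suc j)))"
      by (rule dvd_diff[OF Suc.IH[OF j(1)]])
    then show ?case by simp
  qed simp
  \<comment> \<open>The subscripts in \<open>w\<close> are congruent modulo \<open>d True\<close>
    and one of them is 0, so all are divisible by it; irreducibility then gives
    \<open>d True = 1\<close>.\<close>
  obtain j0 where j0: "j0 < length w" "x j0 = 0"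
    using assms(6) by (auto simp: in_set_conv_nth x_def)
  have dvd: "d True dvd x j" if "j < length w" for j
    using dvd_diff[OF congruent[OF that] congruent[OF j0(1)]] j0(2) by simp
  have "d True dvd i" if i: "i \<in> insert n (fst ` set w)" for i
  proof (cases "i = n")
    case False
    then obtain a where "a \<in> set w" "i = fst a"
      using i by blast
    then obtain j where "j < length w" "i = x j"
      unfolding x_def in_set_conv_nth by blast
    then show ?thesis
      using dvd by simp
  qed (use d(2) in simp)
  then have "d True dvd Gcd (insert n (fst ` set w))"
    by (rule Gcd_greatest)
  then have "d True = 1"
    using assms(8) unfolding irreducible_cyclic_presentation_def by (metis nat_dvd_1_iff_1)
  then have joined: "{v. joined ?G (0, e) v} = {..<n} \<times> {e}" for e
    using d(3)[of e] d_eq[of e] by auto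
  have bipartite: "bipartite_graph (induced ?G ({..<n} \<times> {e}))" for e
    using assms(9) comps[of e] unfolding joined special_def by blast
  have parity: "even n \<and> even (x j) \<noteq> even (x (Suc j mod length w))" if "j < length w" for j
    by (rule bipartite_parity[OF verts n sign shift joined bipartite edge'[OF that] x_less[OF that] x_less[OF suc]])
  have even_n: "even n"
    using parity[of 0] len by linarith
  have x_parity: "even (x j) = (even j = even (x 0))" if "j < length w" for j
    using that
  proof (induction j)
    case (Suc j)
    then have "j < length w" "Suc j mod length w = Suc j"
      by simp_all
    then show ?case
      using parity[of j] Suc.IH by auto
  qed simp
  obtain s where s: "\<And>i. i < length w \<Longrightarrow> snd (w ! i) = (even i = s)" and "even (length w)"
    using alt by (auto simp: sign_alternating_def)
  then obtain m where m: "length w = 2 * m"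
    by (elim evenE)
  \<comment> \<open>Shifting by \<open>c\<close> changes all parities together or none, and
    reduction modulo the even number \<open>n\<close> keeps them. As position 0 is even,
    \<open>x 0\<close> and \<open>s\<close> fix the pattern.\<close>
  have relators: "map (\<lambda>(i, e). (even i, e)) (shift_by n c w) =
      concat (replicate m [(even (x 0) = even c, s), (\<not> (even (x 0) = even c), \<not> s)])" for c
  proof (rule concat_replicate_pair)
    show "length (map (\<lambda>(i, e). (even i, e)) (shift_by n c w)) = 2 * m"
      using m by (simp add: shift_by_def)
    fix i assume "i < length (map (\<lambda>(i, e). (even i, e)) (shift_by n c w))"
    then have i: "i < length w"
      by (simp add: shift_by_def)
    have "map (\<lambda>(i, e). (even i, e)) (shift_by n c w) ! i = (even ((x i + c) mod n), snd (w ! i))"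
      using i by (simp add: shift_by_def x_def case_prod_beta)
    also have "even ((x i + c) mod n) = even (x i + c)"
      using even_n by (simp add: dvd_mod_iff)
    finally show "map (\<lambda>(i, e). (even i, e)) (shift_by n c w) ! i =
        (if even i then (even (x 0) = even c, s) else (\<not> (even (x 0) = even c), \<not> s))"
      using x_parity[OF i] s[OF i] by auto
  qed
  show ?thesis
    unfolding cyclically_presented_group_def
  proof (rule large_presented_group_if_parity_alternating)
    show "is_presentation ?P"
      using assms(9) by (simp add: special_def finite_presentation_def)
    show "fst ?P = {..<n}"
      by (simp add: cyclic_presentation_def)
    show "n \<ge> 2"
      using n even_n by (cases "n = 1") auto
    show "m \<ge> 2"
      using m assms(11) by simp
    fix r assume "r \<in> snd ?P"
    then show "\<exists>s e. map (\<lambda>(i, e). (even i, e)) r = concat (replicate m [(s, e), (\<not> s, \<not> e)])"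
      using relators unfolding relators_cyclic_presentation[OF w n] by blast
  qed
qed

end
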